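(* There exist integers $n>m\geq 2$ and a compact subset $F\subset \mathbb{T}^2$ of the torus such that $F$ is invariant, $F=T(F)$, under the expanding toral endomorphism $$T(x,y)=(mx \ \mathrm{mod}\ 1,\ ny\ \mathrm{mod}\ 1)$$ and $$\underline{\dim}_{\mathrm{B}} F<\overline{\dim}_{\mathrm{B}} F.$$ In particular, the box dimension of $F$ does not exist.
   Context: $\mathbb{T}^2=\mathbb{R}^2/\mathbb{Z}^2$ is the two-dimensional torus with its usual (flat) metric. For a subset $E$ of a separable metric space $X$, the lower and upper box dimensions are $$\underline{\dim}_{\mathrm{B}} E=\liminf_{\delta\to 0}\frac{\log N_\delta(E)}{-\log\delta},\qquad \overline{\dim}_{\mathrm{B}} E=\limsup_{\delta\to 0}\frac{\log N_\delta(E)}{-\log\delta},$$ where $N_\delta(E)$ is the smallest number of sets of diameter $\delta>0$ required to cover $E$. If the lower and upper box dimensions coincide, the common value is called the box dimension of $E$; otherwise one says that the box dimension of $E$ does not exist. *)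

theory Defs
  imports "HOL-Analysis.Analysis" "HOL-Library.Extended_Nat" "HOL-Library.Extended_Real"
begin

section \<open>The flat torus\<close>

definition torus_rel :: "real \<times> real \<Rightarrow> real \<times> real \<Rightarrow> bool" where
  "torus_rel p q \<longleftrightarrow> p - q \<in> \<int> \<times> \<int>"

quotient_type torus = "real \<times> real" / torus_rel
  morphisms rep_torus torus_proj
proof (rule equivpI)
  show "reflp torus_rel"
    by (simp add: reflp_def torus_rel_def zero_prod_def)
  have "q - p \<in> \<int> \<times> \<int>" if "p - q \<in> \<int> \<times> \<int>" for p q :: "real \<times> real"
    using that Ints_minus[of "fst p - fst q"] Ints_minus[of "snd p - snd q"]
    by (simp add: mem_Times_iff)
  then show "symp torus_rel"
    by (simp add: symp_def torus_rel_def)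
  have "p - r \<in> \<int> \<times> \<int>" if "p - q \<in> \<int> \<times> \<int>" "q - r \<in> \<int> \<times> \<int>"
    for p q r :: "real \<times> real"
    using that Ints_add[of "fst p - fst q" "fst q - fst r"]
      Ints_add[of "snd p - snd q" "snd q - snd r"]
    by (simp add: mem_Times_iff)
  then show "transp torus_rel"
    unfolding transp_def torus_rel_def by blast
qed

lemma torus_rel_infdist_le:
  assumes "torus_rel p p'" "torus_rel q q'"
  shows "infdist (p - q) (\<int> \<times> \<int>) \<le> infdist (p' - q') (\<int> \<times> \<int>)"
proof -
  have ne: "(\<int> \<times> \<int> :: (real \<times> real) set) \<noteq> {}" by auto
  show ?thesis
    unfolding infdist_notempty[OF ne, of "p' - q'"]
  proof (rule cINF_greatest[OF ne])
    fix v :: "real \<times> real" assume v: "v \<in> \<int> \<times> \<int>"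
    define w where "w = v + ((p - p') - (q - q'))"
    have "w \<in> \<int> \<times> \<int>"
      using v assms by (auto simp: w_def torus_rel_def mem_Times_iff)
    moreover have "dist (p - q) w = dist (p' - q') v"
      by (simp add: w_def dist_norm algebra_simps)
    ultimately show "infdist (p - q) (\<int> \<times> \<int>) \<le> dist (p' - q') v"
      by (metis infdist_le)
  qed
qed

instantiation torus :: metric_space
begin

text \<open>The flat metric is the Euclidean distance between cosets of \<open>\<int> \<times> \<int>\<close>, that is,
  the infimum over \<open>v \<in> \<int> \<times> \<int>\<close> of the Euclidean norm of \<open>p - q - v\<close>.\<close>

lift_definition dist_torus :: "torus \<Rightarrow> torus \<Rightarrow> real"
  is "\<lambda>p q. infdist (p - q) (\<int> \<times> \<int>)"
  by (intro antisym torus_rel_infdist_le) (auto intro: equivp_symp[OF torus_equivp])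

definition uniformity_torus :: "(torus \<times> torus) filter" where
  "uniformity_torus = (INF e\<in>{0 <..}. principal {(x, y). dist x y < e})"

definition open_torus :: "torus set \<Rightarrow> bool" where
  "open_torus U \<longleftrightarrow> (\<forall>x\<in>U. eventually (\<lambda>(x', y). x' = x \<longrightarrow> y \<in> U) uniformity)"

instance
proof
  fix x y z :: torus
  have ne: "(\<int> \<times> \<int> :: (real \<times> real) set) \<noteq> {}" by auto
  have cl: "closed (\<int> \<times> \<int> :: (real \<times> real) set)"
    by (intro closed_Times closed_Ints)
  show "(dist x y = 0) = (x = y)"
    by transfer (simp add: torus_rel_def in_closed_iff_infdist_zero[OF cl ne])
  show "dist x y \<le> dist x z + dist y z"
  proof transfer
    fix p q r :: "real \<times> real"
    let ?L = "\<int> \<times> \<int> :: (real \<times> real) set"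
    have 1: "infdist (p - q) ?L - infdist (q - r) ?L \<le> dist (p - r) u" if "u \<in> ?L" for u
    proof -
      have "infdist (p - q) ?L - dist (p - r) u \<le> dist (q - r) v" if "v \<in> ?L" for v
      proof -
        have "u - v \<in> ?L" using \<open>u \<in> ?L\<close> \<open>v \<in> ?L\<close> by (auto simp: mem_Times_iff)
        then have "infdist (p - q) ?L \<le> dist (p - q) (u - v)" by (rule infdist_le)
        also have "\<dots> = norm ((p - r - u) - (q - r - v))"
          by (simp add: dist_norm algebra_simps)
        also have "\<dots> \<le> dist (p - r) u + dist (q - r) v"
          unfolding dist_norm by (rule norm_triangle_ineq4)
        finally show ?thesis by simp
      qed
      then have "infdist (p - q) ?L - dist (p - r) u \<le> infdist (q - r) ?L"
        unfolding infdist_notempty[OF ne, of "q - r"] by (intro cINF_greatest[OF ne])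
      then show ?thesis by simp
    qed
    have "infdist (p - q) ?L - infdist (q - r) ?L \<le> infdist (p - r) ?L"
      unfolding infdist_notempty[OF ne, of "p - r"] by (intro cINF_greatest[OF ne] 1)
    then show "infdist (p - q) ?L \<le> infdist (p - r) ?L + infdist (q - r) ?L" by simp
  qed
qed (simp_all add: uniformity_torus_def open_torus_def)

end

lift_definition toral_endo :: "int \<Rightarrow> int \<Rightarrow> torus \<Rightarrow> torus"
  is "\<lambda>m n (x, y). (frac (of_int m * x), frac (of_int n * y))"
proof -
  have *: "frac (of_int k * x) = frac (of_int k * x')" if "x - x' \<in> \<int>" for k and x x' :: real
  proof -
    have "of_int k * x - of_int k * x' \<in> \<int>"
      using Ints_mult[OF Ints_of_int that, of k] by (simp add: right_diff_distrib)
    then obtain j where "of_int k * x - of_int k * x' = of_int j"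
      by (rule Ints_cases)
    then have "of_int k * x = of_int k * x' + of_int j" by simp
    then show ?thesis by (simp add: frac_def)
  qed
  show "torus_rel (case p of (x, y) \<Rightarrow> (frac (of_int m * x), frac (of_int n * y)))
                  (case q of (x, y) \<Rightarrow> (frac (of_int m * x), frac (of_int n * y)))"
    if "torus_rel p q" for m n p q
    using that *
    by (auto simp: torus_rel_def mem_Times_iff split: prod.splits)
qed


section \<open>Box dimensions\<close>

text \<open>As usual, a set "of diameter \<open>\<delta>\<close>" in a cover means one of diameter at most \<open>\<delta>\<close>.
  Boundedness is required separately because the value of \<^const>\<open>diameter\<close> is
  unspecified on unbounded sets. The value is \<open>\<infinity>\<close> if there is no finite cover.\<close>

definition covering_number :: "real \<Rightarrow> 'a::metric_space set \<Rightarrow> enat" where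
  "covering_number \<delta> E =
    (INF \<C> \<in> {\<C>. finite \<C> \<and> E \<subseteq> \<Union>\<C> \<and> (\<forall>U\<in>\<C>. bounded U \<and> diameter U \<le> \<delta>)}. enat (card \<C>))"

text \<open>The logarithm is extended by \<open>log 0 = -\<infinity>\<close> (only relevant for the empty set) and
  \<open>log \<infinity> = \<infinity>\<close> (only relevant for sets that are not totally bounded).\<close>

definition log_enat :: "enat \<Rightarrow> ereal" where
  "log_enat N = (case N of enat k \<Rightarrow> if k = 0 then -\<infinity> else ereal (ln (real k)) | \<infinity> \<Rightarrow> \<infinity>)"

definition lower_box_dim :: "'a::metric_space set \<Rightarrow> ereal" where
  "lower_box_dim E =
    Liminf (at_right 0) (\<lambda>\<delta>. log_enat (covering_number \<delta> E) / ereal (- ln \<delta>))"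

definition upper_box_dim :: "'a::metric_space set \<Rightarrow> ereal" where
  "upper_box_dim E =
    Limsup (at_right 0) (\<lambda>\<delta>. log_enat (covering_number \<delta> E) / ereal (- ln \<delta>))"

definition has_box_dim :: "'a::metric_space set \<Rightarrow> ereal \<Rightarrow> bool" where
  "has_box_dim E d \<longleftrightarrow> lower_box_dim E = d \<and> upper_box_dim E = d"

end

theory Submission
  imports Defs "HOL-Real_Asymp.Real_Asymp"
begin

text \<open>
  The example lives over \<open>m = 2\<close>, \<open>n = 4\<close>. It consists of the vertical circle, the horizontal
  circle, and a family of short horizontal segments (the teeth of a comb) attached to the
  vertical circle: for every \<open>g\<close> in the sparse set of factorials and every \<open>t\<close>, the segments
  \<open>[0, 2\<^sup>-\<^sup>t\<^sup>-\<^sup>g]\<close> at the heights \<open>p / 4\<^sup>t\<close> with \<open>p < 16\<^sup>g\<close>. In symbols, reading a point as its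
  sequence of pairs (binary digit of \<open>x\<close>, quaternary digit of \<open>y\<close>), such a point starts with
  zeros and \<open>2 g\<close> pairs in which only the \<open>y\<close>-digit is free (for \<open>t < 2 g\<close>, just the last \<open>t\<close>
  of these), continues with a gap of \<open>g\<close> zero pairs, and ends with pairs in which only the
  \<open>x\<close>-digit is free.

  The endomorphism deletes the first pair, so it carries the teeth with parameters \<open>(g, t + 1)\<close>
  onto those with parameters \<open>(g, t)\<close>, and those with \<open>t = 0\<close> into the horizontal circle. As
  both circles are mapped onto themselves, the set is invariant. It is compact because all but
  finitely many of the sets of teeth lie in a given neighbourhood of the vertical circle.

  A square of side \<open>2\<^sup>-\<^sup>d\<close> determines \<open>d\<close> binary digits of \<open>x\<close>, but only the first \<open>d / 2\<close>
  quaternary digits of \<open>y\<close>. At \<open>d = 4 g\<close> with \<open>g\<close> a factorial this window sees all \<open>2 g\<close> free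
  \<open>y\<close>-digits (two bits each) of the teeth with \<open>t = 2 g\<close>, and \<open>g\<close> further free \<open>x\<close>-digits
  beyond the gap. That makes \<open>2\<^sup>5\<^sup>g\<close> separated points, and the upper box dimension is at least
  \<open>5 / 4\<close>; the slightly smaller bound \<open>6 / 5\<close> leaves room for a factor \<open>2\<close> in the scale
  (\<open>covering_number_comb_ge\<close>, \<open>upper_box_dim_comb_ge\<close>).

  At \<open>d = (i + 1)!\<close> the window is too short for the gaps \<open>g \<ge> d\<close>: those teeth are
  indistinguishable from the vertical circle. The gaps \<open>g \<le> i!\<close> are tiny compared with \<open>d\<close>, so
  the teeth belonging to them that are longer than \<open>2\<^sup>-\<^sup>d\<close>, which forces \<open>t < d\<close>, lie at no more
  than \<open>d 16\<^bsup>i!\<^esup> = 2\<^bsup>o(d)\<^esup>\<close> heights. Each height costs at most \<open>2\<^sup>d\<close> squares, so that the lower box dimension is at most \<open>1\<close>; the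
  weaker bound \<open>9 / 8\<close> suffices (\<open>covering_number_comb_le\<close>, \<open>lower_box_dim_comb_le\<close>).
\<close>

section \<open>The quotient map onto the torus\<close>

lemma torus_proj_eq_iff: "torus_proj p = torus_proj q \<longleftrightarrow> p - q \<in> \<int> \<times> \<int>"
  using torus.abs_eq_iff[of p q] by (simp add: torus_rel_def)

lemma dist_torus_proj: "dist (torus_proj p) (torus_proj q) = infdist (p - q) (\<int> \<times> \<int>)"
  by (rule dist_torus.abs_eq)

lemma dist_torus_proj_le: "dist (torus_proj p) (torus_proj q) \<le> dist p q"
proof -
  have "infdist (p - q) (\<int> \<times> \<int>) \<le> dist (p - q) 0"
    by (rule infdist_le) (simp add: zero_prod_def)
  then show ?thesis
    by (simp add: dist_torus_proj dist_norm)
qed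

lemma continuous_on_torus_proj: "continuous_on S torus_proj"
  unfolding continuous_on_iff using dist_torus_proj_le by (meson le_less_trans)

lemma toral_endo_torus_proj:
  "toral_endo m n (torus_proj (x, y)) = torus_proj (of_int m * x, of_int n * y)"
proof -
  have "frac z - z \<in> \<int>" for z :: real
    by (simp add: frac_def)
  then show ?thesis
    by (simp add: toral_endo.abs_eq torus_proj_eq_iff)
qed

lemma torus_proj_eq_frac: "torus_proj (x, y) = torus_proj (frac x, frac y)"
  by (simp add: torus_proj_eq_iff frac_def)

lemma vertical_circle_eq: "torus_proj ` ({0} \<times> UNIV) = torus_proj ` ({0} \<times> {0..1})"
proof -
  have "torus_proj (0, y) = torus_proj (0, frac y)" for y
    by (metis torus_proj_eq_frac frac_of_int of_int_0)
  moreover have "frac y \<in> {0..1}" for y :: real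
    using frac_lt_1[of y] by simp
  ultimately show ?thesis
    by (force simp: image_iff)
qed

lemma horizontal_circle_eq: "torus_proj ` (UNIV \<times> {0}) = torus_proj ` ({0..1} \<times> {0})"
proof -
  have "torus_proj (x, 0) = torus_proj (frac x, 0)" for x
    by (metis torus_proj_eq_frac frac_of_int of_int_0)
  moreover have "frac x \<in> {0..1}" for x :: real
    using frac_lt_1[of x] by simp
  ultimately show ?thesis
    by (force simp: image_iff)
qed

section \<open>Compactness of a set with accumulating pieces\<close>

text \<open>A finite subcover of \<open>K\<close> already covers all but finitely many of the pieces \<open>S i\<close>; the
  remaining ones form a compact set.\<close>

lemma compact_Un_Union_accumulating:
  fixes K :: "'a::topological_space set"
  assumes K: "compact K" and S: "\<And>i. i \<in> I \<Longrightarrow> compact (S i)"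
    and fin: "\<And>U. open U \<Longrightarrow> K \<subseteq> U \<Longrightarrow> finite {i \<in> I. \<not> S i \<subseteq> U}"
  shows "compact (K \<union> (\<Union>i\<in>I. S i))"
proof (rule compactI)
  fix \<C> :: "'a set set"
  assume op: "\<forall>U\<in>\<C>. open U" and cov: "K \<union> (\<Union>i\<in>I. S i) \<subseteq> \<Union>\<C>"
  have "K \<subseteq> \<Union>\<C>" using cov by blast
  then obtain \<D> where D: "\<D> \<subseteq> \<C>" "finite \<D>" "K \<subseteq> \<Union>\<D>"
    using op by (auto elim: compactE[OF K])
  define J where "J = {i \<in> I. \<not> S i \<subseteq> \<Union>\<D>}"
  have "finite J"
    unfolding J_def using D op by (intro fin open_Union) auto
  then have "compact (\<Union>i\<in>J. S i)"
    using S by (intro compact_UN) (auto simp: J_def)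
  moreover have "(\<Union>i\<in>J. S i) \<subseteq> \<Union>\<C>"
    using cov by (auto simp: J_def)
  moreover have "\<And>U. U \<in> \<C> \<Longrightarrow> open U"
    using op by blast
  ultimately obtain \<E> where E: "\<E> \<subseteq> \<C>" "finite \<E>" "(\<Union>i\<in>J. S i) \<subseteq> \<Union>\<E>"
    by (rule compactE)
  have "K \<union> (\<Union>i\<in>I. S i) \<subseteq> \<Union>(\<D> \<union> \<E>)"
    using D(3) E(3) unfolding J_def by blast
  then show "\<exists>\<C>'\<subseteq>\<C>. finite \<C>' \<and> K \<union> (\<Union>i\<in>I. S i) \<subseteq> \<Union>\<C>'"
    using D E by (metis finite_UnI le_sup_iff)
qed

section \<open>Estimating box dimensions along a sequence of scales\<close>

lemma covering_number_le_card:
  assumes "finite I" "E \<subseteq> (\<Union>i\<in>I. U i)"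
    and "\<And>i. i \<in> I \<Longrightarrow> bounded (U i) \<and> diameter (U i) \<le> \<delta>"
  shows "covering_number \<delta> E \<le> enat (card I)"
proof -
  have "covering_number \<delta> E \<le> enat (card (U ` I))"
    unfolding covering_number_def using assms by (intro INF_lower) auto
  also have "\<dots> \<le> enat (card I)"
    using assms(1) by (simp add: card_image_le)
  finally show ?thesis .
qed

text \<open>A set of diameter at most \<open>\<delta>\<close> contains at most one point of a \<open>\<delta>\<close>-separated set.\<close>

lemma card_separated_le_covering_number:
  assumes P: "P \<subseteq> E" and sep: "\<And>x y. x \<in> P \<Longrightarrow> y \<in> P \<Longrightarrow> x \<noteq> y \<Longrightarrow> \<delta> < dist x y"
  shows "enat (card P) \<le> covering_number \<delta> E"
  unfolding covering_number_def
proof (rule INF_greatest, clarify)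
  fix \<C> assume C: "finite \<C>" "E \<subseteq> \<Union>\<C>" "\<forall>U\<in>\<C>. bounded U \<and> diameter U \<le> \<delta>"
  have "\<forall>x\<in>P. \<exists>U\<in>\<C>. x \<in> U" using P C(2) by blast
  then obtain f where f: "\<And>x. x \<in> P \<Longrightarrow> f x \<in> \<C> \<and> x \<in> f x" by metis
  have "inj_on f P"
  proof (rule inj_onI, rule ccontr)
    fix x y assume xy: "x \<in> P" "y \<in> P" "f x = f y" "x \<noteq> y"
    then have "dist x y \<le> diameter (f x)"
      using f C(3) by (metis diameter_bounded_bound)
    with xy sep f C(3) show False by (meson le_less_trans not_less order_trans)
  qed
  moreover have "f ` P \<subseteq> \<C>" using f by blast
  ultimately show "enat (card P) \<le> enat (card \<C>)"
    using C(1) by (simp add: card_inj_on_le)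
qed

lemma log_enat_mono: "a \<le> b \<Longrightarrow> log_enat a \<le> log_enat b"
  by (cases a; cases b) (auto simp: log_enat_def)

text \<open>Since a lower (upper) limit is bounded above (below) by the values along any one sequence of
  scales tending to \<open>0\<close>, it is enough to count at well-chosen scales.\<close>

lemma lower_box_dim_le:
  assumes lim: "filterlim \<delta> (at_right 0) sequentially"
    and bound: "\<forall>\<^sub>F i in sequentially. 0 < N i \<and> covering_number (\<delta> i) E \<le> enat (N i)
                  \<and> ln (real (N i)) \<le> c * (- ln (\<delta> i))"
  shows "lower_box_dim E \<le> ereal c"
proof (rule ccontr)
  assume "\<not> lower_box_dim E \<le> ereal c"
  then have "\<forall>\<^sub>F \<delta> in at_right 0. ereal c < log_enat (covering_number \<delta> E) / ereal (- ln \<delta>)"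
    unfolding lower_box_dim_def by (intro less_LiminfD) (simp add: not_le)
  then have "\<forall>\<^sub>F i in sequentially. ereal c < log_enat (covering_number (\<delta> i) E) / ereal (- ln (\<delta> i))"
    using lim by (rule eventually_compose_filterlim)
  moreover have "\<forall>\<^sub>F i in sequentially. 0 < \<delta> i \<and> \<delta> i < 1"
    using eventually_compose_filterlim[OF eventually_at_right_real[of 0 1] lim] by simp
  ultimately have "\<forall>\<^sub>F i in sequentially. False"
    using bound
  proof eventually_elim
    case (elim i)
    then have pos: "0 < - ln (\<delta> i)" by simp
    have "log_enat (covering_number (\<delta> i) E) \<le> log_enat (enat (N i))"
      using elim by (intro log_enat_mono) auto
    also have "\<dots> = ereal (ln (real (N i)))"
      using elim by (simp add: log_enat_def)
    finally have "log_enat (covering_number (\<delta> i) E) / ereal (- ln (\<delta> i))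
        \<le> ereal (ln (real (N i))) / ereal (- ln (\<delta> i))"
      using pos by (intro ereal_divide_right_mono) auto
    also have "\<dots> = ereal (ln (real (N i)) / (- ln (\<delta> i)))"
      using pos by simp
    also have "\<dots> \<le> ereal c"
      using pos elim unfolding ereal_less_eq by (subst pos_divide_le_eq) auto
    finally show False using elim by (meson not_less)
  qed
  then show False by simp
qed

lemma upper_box_dim_ge:
  assumes lim: "filterlim \<delta> (at_right 0) sequentially"
    and bound: "\<forall>\<^sub>F i in sequentially. 0 < N i \<and> enat (N i) \<le> covering_number (\<delta> i) E
                  \<and> c * (- ln (\<delta> i)) \<le> ln (real (N i))"
  shows "ereal c \<le> upper_box_dim E"
proof (rule ccontr)
  assume "\<not> ereal c \<le> upper_box_dim E"
  then have "\<forall>\<^sub>F \<delta> in at_right 0. log_enat (covering_number \<delta> E) / ereal (- ln \<delta>) < ereal c"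
    unfolding upper_box_dim_def by (intro Limsup_lessD) (simp add: not_le)
  then have "\<forall>\<^sub>F i in sequentially. log_enat (covering_number (\<delta> i) E) / ereal (- ln (\<delta> i)) < ereal c"
    using lim by (rule eventually_compose_filterlim)
  moreover have "\<forall>\<^sub>F i in sequentially. 0 < \<delta> i \<and> \<delta> i < 1"
    using eventually_compose_filterlim[OF eventually_at_right_real[of 0 1] lim] by simp
  ultimately have "\<forall>\<^sub>F i in sequentially. False"
    using bound
  proof eventually_elim
    case (elim i)
    then have pos: "0 < - ln (\<delta> i)" by simp
    have "ereal c \<le> ereal (ln (real (N i)) / (- ln (\<delta> i)))"
      using pos elim unfolding ereal_less_eq by (subst pos_le_divide_eq) auto
    also have "\<dots> = ereal (ln (real (N i))) / ereal (- ln (\<delta> i))"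
      using pos by simp
    also have "ereal (ln (real (N i))) = log_enat (enat (N i))"
      using elim by (simp add: log_enat_def)
    also have "log_enat (enat (N i)) / ereal (- ln (\<delta> i))
        \<le> log_enat (covering_number (\<delta> i) E) / ereal (- ln (\<delta> i))"
      using pos elim by (intro ereal_divide_right_mono log_enat_mono) auto
    finally show False using elim by (meson not_less)
  qed
  then show False by simp
qed

section \<open>Two counting estimates on the torus\<close>

lemma diameter_torus_box_le:
  assumes "0 \<le> h"
  shows "bounded (torus_proj ` ({a..a + h} \<times> {b..b + h}))
    \<and> diameter (torus_proj ` ({a..a + h} \<times> {b..b + h})) \<le> 2 * h"
proof -
  have le: "dist p q \<le> 2 * h"
    if pq: "p \<in> torus_proj ` ({a..a + h} \<times> {b..b + h})"
      "q \<in> torus_proj ` ({a..a + h} \<times> {b..b + h})" for p q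
  proof -
    obtain x y x' y' where *: "p = torus_proj (x, y)" "q = torus_proj (x', y')"
      "x \<in> {a..a + h}" "x' \<in> {a..a + h}" "y \<in> {b..b + h}" "y' \<in> {b..b + h}"
      using pq by auto
    have "dist p q \<le> dist (x, y) (x', y')"
      unfolding * by (rule dist_torus_proj_le)
    also have "\<dots> \<le> dist x x' + dist y y'"
      unfolding dist_prod_def by (simp add: sqrt_sum_squares_le_sum)
    also have "\<dots> \<le> 2 * h"
      using * by (auto simp: dist_real_def)
    finally show ?thesis .
  qed
  then have "bounded (torus_proj ` ({a..a + h} \<times> {b..b + h}))"
    unfolding bounded_two_points by blast
  moreover have "diameter (torus_proj ` ({a..a + h} \<times> {b..b + h})) \<le> 2 * h"
    using le assms unfolding diameter_def
    by (auto intro!: cSUP_least simp del: image_eqI)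
  ultimately show ?thesis by blast
qed

lemma frac_in_grid_cell:
  assumes "0 < M"
  obtains k where "k < M" "frac x \<in> {real k / real M..real k / real M + 1 / real M}"
proof
  define k where "k = nat \<lfloor>real M * frac x\<rfloor>"
  have f: "0 \<le> frac x" "frac x < 1" by (auto simp: frac_lt_1)
  have k: "real k \<le> real M * frac x" "real M * frac x < real k + 1"
    using f by (auto simp: k_def)
  have "real M * frac x < real M" using f assms by simp
  then show "k < M" using k by linarith
  show "frac x \<in> {real k / real M..real k / real M + 1 / real M}"
    using k assms by (simp add: field_simps)
qed

text \<open>With a grid of mesh \<open>1 / M\<close>, the strip around the vertical circle needs one column of \<open>M\<close>
  squares, and each horizontal circle one row of \<open>M\<close> squares. The scale is \<open>2 / M\<close>
  because the squares have diameter larger than their side.\<close>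

lemma covering_number_strip_and_circles_le:
  assumes M: "0 < M" and Y: "finite Y"
    and E: "E \<subseteq> torus_proj ` ({0..1 / real M} \<times> UNIV) \<union> torus_proj ` (UNIV \<times> Y)"
  shows "covering_number (2 / real M) E \<le> enat (M * (1 + card Y))"
proof -
  \<comment> \<open>The rows start exactly at the heights in \<open>Y\<close>, so that one row is enough for each circle.\<close>
  define corners where "corners = (\<lambda>k. (0, real k / real M)) ` {..<M}
    \<union> (\<lambda>(k, y). (real k / real M, frac y)) ` ({..<M} \<times> Y)"
  define box where "box = (\<lambda>(a, b). torus_proj ` ({a..a + 1 / real M} \<times> {b..b + 1 / real M}))"
  have "E \<subseteq> (\<Union>c\<in>corners. box c)"
  proof
    fix z assume "z \<in> E"
    then consider x y where "z = torus_proj (x, y)" "x \<in> {0..1 / real M}"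
      | x y where "z = torus_proj (x, y)" "y \<in> Y"
      using E by auto
    then show "z \<in> (\<Union>c\<in>corners. box c)"
    proof cases
      case 1
      obtain k where k: "k < M" "frac y \<in> {real k / real M..real k / real M + 1 / real M}"
        using frac_in_grid_cell[OF M] .
      have "z = torus_proj (x, frac y)"
        unfolding 1 by (simp add: torus_proj_eq_iff frac_def)
      then have "z \<in> box (0, real k / real M)"
        using 1 k by (auto simp: box_def)
      then show ?thesis using k by (auto simp: corners_def)
    next
      case 2
      obtain k where k: "k < M" "frac x \<in> {real k / real M..real k / real M + 1 / real M}"
        using frac_in_grid_cell[OF M] .
      have "z \<in> box (real k / real M, frac y)"
        using 2 k torus_proj_eq_frac[of x y] by (auto simp: box_def)
      then show ?thesis using k 2 by (force simp: corners_def)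
    qed
  qed
  then have "covering_number (2 / real M) E \<le> enat (card corners)"
    using diameter_torus_box_le[of "1 / real M"] Y
    by (intro covering_number_le_card[where U = box]) (auto simp: corners_def box_def)
  also have "card corners \<le> M + M * card Y"
  proof -
    have "card corners \<le> card ((\<lambda>k. (0::real, real k / real M)) ` {..<M})
        + card ((\<lambda>(k, y). (real k / real M, frac y)) ` ({..<M} \<times> Y))"
      unfolding corners_def by (rule card_Un_le)
    also have "\<dots> \<le> card {..<M} + card ({..<M} \<times> Y)"
      using Y by (intro add_mono card_image_le) auto
    finally show ?thesis by (simp add: card_cartesian_product)
  qed
  finally show ?thesis by (simp add: algebra_simps)
qed

text \<open>The difference of two grid points and a lattice vector is again a vector with coordinates in
  \<open>(1 / M) \<int>\<close>; being nonzero, it has norm at least \<open>1 / M\<close>.\<close>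

lemma grid_points_separated:
  assumes M: "0 < M" and ne: "torus_proj (of_int a / real M, of_int b / real M)
      \<noteq> torus_proj (of_int a' / real M, of_int b' / real M)"
  shows "1 / real M \<le> dist (torus_proj (of_int a / real M, of_int b / real M))
      (torus_proj (of_int a' / real M, of_int b' / real M))"
proof -
  let ?p = "(of_int a / real M, of_int b / real M)"
  let ?q = "(of_int a' / real M, of_int b' / real M)"
  have int_le: "1 / real M \<le> \<bar>of_int k / real M\<bar>" if "k \<noteq> 0" for k :: int
    using that M by (simp add: divide_right_mono)
  have "1 / real M \<le> dist (?p - ?q) v" if v: "v \<in> \<int> \<times> \<int>" for v
  proof -
    obtain r s where rs: "v = (of_int r, of_int s)"
      using v by (auto elim!: Ints_cases)
    have eq: "?p - ?q - v = (of_int (a - a' - r * int M) / real M, of_int (b - b' - s * int M) / real M)"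
      using M by (simp add: rs field_simps)
    have "?p - ?q \<noteq> v"
      using ne v by (auto simp: torus_proj_eq_iff)
    then have "a - a' - r * int M \<noteq> 0 \<or> b - b' - s * int M \<noteq> 0"
      using eq by (metis div_0 eq_iff_diff_eq_0 of_int_0 zero_prod_def)
    then have "1 / real M \<le> norm (?p - ?q - v)"
      using int_le norm_fst_le norm_snd_le unfolding eq
      by (smt (verit) real_norm_def)
    then show ?thesis by (simp add: dist_norm)
  qed
  moreover have "(\<int> \<times> \<int> :: (real \<times> real) set) \<noteq> {}" by auto
  ultimately show ?thesis
    unfolding dist_torus_proj by (subst infdist_notempty) (auto intro!: cINF_greatest)
qed

lemma covering_number_grid_ge:
  assumes M: "0 < M" and AB: "A \<le> M" "B \<le> M" and \<delta>: "\<delta> < 1 / real M"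
    and E: "\<And>a b. a < A \<Longrightarrow> b < B \<Longrightarrow> torus_proj (real a / real M, real b / real M) \<in> E"
  shows "enat (A * B) \<le> covering_number \<delta> E"
proof -
  define f where "f = (\<lambda>(a, b). torus_proj (real a / real M, real b / real M))"
  have "inj_on f ({..<A} \<times> {..<B})"
  proof (rule inj_onI, clarify)
    fix a b a' b' assume *: "a < A" "b < B" "a' < A" "b' < B" "f (a, b) = f (a', b')"
    have "real a / real M - real a' / real M \<in> \<int>" "real b / real M - real b' / real M \<in> \<int>"
      using *(5) by (auto simp: f_def torus_proj_eq_iff)
    then obtain r s where rs: "real a / real M - real a' / real M = of_int r"
        "real b / real M - real b' / real M = of_int s"
      by (auto elim!: Ints_cases)
    have lt: "\<bar>real c / real M - real c' / real M\<bar> < 1" if "c < M" "c' < M" for c c'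
      using that M by (simp add: field_simps abs_less_iff)
    have "\<bar>of_int r\<bar> < (1::real)" "\<bar>of_int s\<bar> < (1::real)"
      using lt[of a a'] lt[of b b'] * AB unfolding rs by auto
    then have "r = 0" "s = 0" by linarith+
    then show "a = a' \<and> b = b'" using rs M by simp
  qed
  then have "card (f ` ({..<A} \<times> {..<B})) = A * B"
    by (simp add: card_image card_cartesian_product)
  moreover have "enat (card (f ` ({..<A} \<times> {..<B}))) \<le> covering_number \<delta> E"
  proof (rule card_separated_le_covering_number)
    show "f ` ({..<A} \<times> {..<B}) \<subseteq> E" using E by (auto simp: f_def)
    fix x y assume "x \<in> f ` ({..<A} \<times> {..<B})" "y \<in> f ` ({..<A} \<times> {..<B})" "x \<noteq> y"
    then obtain a b a' b' where "x = f (a, b)" "y = f (a', b')" by auto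
    then show "\<delta> < dist x y"
      using grid_points_separated[OF M, of "int a" "int b" "int a'" "int b'"] \<open>x \<noteq> y\<close> \<delta>
      by (simp add: f_def)
  qed
  ultimately show ?thesis by simp
qed

section \<open>The invariant set\<close>

text \<open>The ordinates \<open>p / 4 ^ t\<close> may exceed \<open>1\<close>. Leaving it to the quotient map to reduce them gives
  one formula for all \<open>t\<close>: for \<open>t \<le> 2 * g\<close> they are all multiples of \<open>1 / 4 ^ t\<close> modulo \<open>1\<close>, and
  for larger \<open>t\<close> only those with \<open>t - 2 * g\<close> leading zeros.\<close>

definition teeth :: "nat \<Rightarrow> nat \<Rightarrow> torus set" where
  "teeth g t = torus_proj ` ({0..1 / 2 ^ (t + g)} \<times> (\<lambda>p. real p / 4 ^ t) ` {..<16 ^ g})"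

text \<open>The factorials serve as a sequence in which each term is negligible compared with the next.
  All values of \<open>t\<close> occur, those above \<open>2 * g\<close> being there to provide preimages.\<close>

definition comb :: "torus set" where
  "comb = torus_proj ` ({0} \<times> UNIV) \<union> torus_proj ` (UNIV \<times> {0})
     \<union> (\<Union>(j, t)\<in>UNIV. teeth (fact j) t)"

lemma toral_endo_image_Times:
  "toral_endo m n ` torus_proj ` (A \<times> B) =
     torus_proj ` (((*) (of_int m) ` A) \<times> ((*) (of_int n) ` B))"
  by (force simp: toral_endo_torus_proj image_iff)

lemma surj_mult_left: "a \<noteq> 0 \<Longrightarrow> range ((*) a) = (UNIV :: real set)"
  by (rule surjI[where f = "\<lambda>y. y / a"]) simp

lemma toral_endo_teeth_Suc: "toral_endo 2 4 ` teeth g (Suc t) = teeth g t"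
proof -
  have "(*) 2 ` {0..1 / 2 ^ (Suc t + g)} = {0..1 / 2 ^ (t + g) :: real}"
    by (simp add: image_mult_atLeastAtMost)
  moreover have "(*) 4 ` (\<lambda>p. real p / 4 ^ Suc t) ` {..<16 ^ g}
      = (\<lambda>p. real p / 4 ^ t) ` {..<16 ^ g}"
    by (auto simp: image_image)
  ultimately show ?thesis
    by (simp add: teeth_def toral_endo_image_Times)
qed

lemma toral_endo_teeth_0: "toral_endo 2 4 ` teeth g 0 \<subseteq> torus_proj ` (UNIV \<times> {0})"
proof -
  have "torus_proj (x, 4 * real p) = torus_proj (x, 0)" for x p
    by (simp add: torus_proj_eq_iff)
  then show ?thesis
    by (force simp: teeth_def toral_endo_torus_proj)
qed

lemma toral_endo_comb: "toral_endo 2 4 ` comb = comb"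
proof -
  let ?T = "toral_endo 2 4" and ?V = "torus_proj ` ({0} \<times> UNIV)" and ?H = "torus_proj ` (UNIV \<times> {0})"
  have VH: "?T ` ?V = ?V" "?T ` ?H = ?H"
    by (simp_all add: toral_endo_image_Times surj_mult_left)
  have "?T ` teeth (fact j) t \<subseteq> comb" for j t
  proof (cases t)
    case 0
    then show ?thesis
      using toral_endo_teeth_0[of "fact j"] by (auto simp: comb_def)
  next
    case (Suc t')
    then show ?thesis
      using toral_endo_teeth_Suc[of "fact j" t'] by (auto simp: comb_def)
  qed
  moreover have "?T ` (?V \<union> ?H) \<subseteq> comb"
    unfolding image_Un VH by (simp add: comb_def)
  ultimately have forward: "?T ` comb \<subseteq> comb"
    by (subst comb_def) (auto simp: image_Un image_UN)
  have "teeth (fact j) t \<subseteq> ?T ` comb" for j t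
  proof -
    have "teeth (fact j) (Suc t) \<subseteq> comb"
      by (auto simp: comb_def)
    then have "?T ` teeth (fact j) (Suc t) \<subseteq> ?T ` comb"
      by (rule image_mono)
    then show ?thesis
      unfolding toral_endo_teeth_Suc .
  qed
  moreover have "?V \<union> ?H \<subseteq> ?T ` comb"
  proof -
    have "?T ` (?V \<union> ?H) \<subseteq> ?T ` comb"
      unfolding comb_def by (intro image_mono) auto
    then show ?thesis
      unfolding image_Un VH .
  qed
  ultimately have "comb \<subseteq> ?T ` comb"
    by (subst comb_def) (intro Un_least UN_least, auto)
  with forward show ?thesis by (rule antisym)
qed

lemma compact_teeth: "compact (teeth g t)"
  unfolding teeth_def
  by (intro compact_continuous_image continuous_on_torus_proj compact_Times compact_Icc
      finite_imp_compact finite_imageI finite_lessThan)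

text \<open>Both a large \<open>j\<close> and a large \<open>t\<close> make the teeth short, and short teeth stay close to the
  vertical circle.\<close>

lemma compact_comb: "compact comb"
proof -
  let ?V = "torus_proj ` ({0} \<times> UNIV)" and ?H = "torus_proj ` (UNIV \<times> {0})"
  have compact_V: "compact ?V"
    unfolding vertical_circle_eq
    by (intro compact_continuous_image continuous_on_torus_proj compact_Times) auto
  have compact_H: "compact ?H"
    unfolding horizontal_circle_eq
    by (intro compact_continuous_image continuous_on_torus_proj compact_Times) auto
  have "compact ((?V \<union> ?H) \<union> (\<Union>i\<in>UNIV. case i of (j, t) \<Rightarrow> teeth (fact j) t))"
  proof (rule compact_Un_Union_accumulating)
    show "compact (?V \<union> ?H)"
      using compact_V compact_H by (rule compact_Un)
    show "compact (case i of (j, t) \<Rightarrow> teeth (fact j) t)" for i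
      by (cases i) (simp add: compact_teeth)
    fix U assume U: "open U" "?V \<union> ?H \<subseteq> U"
    then obtain e where e: "e > 0" "(\<Union>z\<in>?V. ball z e) \<subseteq> U"
      using compact_subset_open_imp_ball_epsilon_subset[OF compact_V, of U] by blast
    obtain n where n: "1 / 2 ^ n < e"
      using real_arch_pow_inv[of e "1 / 2"] e(1) by (auto simp: power_divide)
    have sub: "teeth (fact j) t \<subseteq> U" if "n \<le> j \<or> n \<le> t" for j t
    proof
      fix z assume "z \<in> teeth (fact j) t"
      then obtain x y where z: "z = torus_proj (x, y)" "0 \<le> x" "x \<le> 1 / 2 ^ (t + fact j)"
        by (auto simp: teeth_def)
      have "n \<le> t + fact j"
        using that fact_ge_self[of j] by linarith
      then have "(1::real) / 2 ^ (t + fact j) \<le> 1 / 2 ^ n"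
        by (intro divide_left_mono power_increasing) auto
      then have "dist (0, y) (x, y) < e"
        using z n by (simp add: dist_Pair_Pair dist_real_def)
      then have "dist (torus_proj (0, y)) z < e"
        unfolding z using dist_torus_proj_le le_less_trans by blast
      moreover have "torus_proj (0, y) \<in> ?V" by simp
      ultimately show "z \<in> U"
        using e(2) by (meson UN_I mem_ball subsetD)
    qed
    have "{i \<in> UNIV. \<not> (case i of (j, t) \<Rightarrow> teeth (fact j) t) \<subseteq> U} \<subseteq> {..<n} \<times> {..<n}"
      using sub by (auto simp: not_less[symmetric])
    then show "finite {i \<in> UNIV. \<not> (case i of (j, t) \<Rightarrow> teeth (fact j) t) \<subseteq> U}"
      by (rule finite_subset) auto
  qed
  then show ?thesis
    unfolding comb_def .
qed

section \<open>Box dimensions of the invariant set\<close>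

text \<open>Teeth shorter than \<open>2\<^sup>-\<^sup>d\<close> disappear in the strip around the vertical circle. The others have
  \<open>t + fact j < fact (Suc i)\<close>, hence \<open>j \<le> i\<close>. They are simply replaced by full horizontal
  circles, as their number is subexponential in \<open>d\<close>.\<close>

lemma covering_number_comb_le:
  fixes i :: nat
  defines "d \<equiv> fact (Suc i)"
  shows "covering_number (2 / 2 ^ d) comb \<le> enat (2 ^ d * (1 + d * 16 ^ fact i))"
proof -
  define Y where "Y = (\<lambda>(t, p). real p / 4 ^ t) ` ({..<d} \<times> {..<16 ^ fact i :: nat})"
  have Y_I: "real p / 4 ^ t \<in> Y" if "t < d" "p < 16 ^ fact i" for t p
    unfolding Y_def using that by (intro image_eqI[of _ _ "(t, p)"]) simp_all
  have "0 \<in> Y"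
    using Y_I[of 0 0] by (simp add: d_def del: fact_Suc)
  have teeth: "teeth (fact j) t \<subseteq> torus_proj ` ({0..1 / 2 ^ d} \<times> UNIV) \<union> torus_proj ` (UNIV \<times> Y)"
    for j t
  proof (cases "d \<le> t + fact j")
    case True
    then have "(1::real) / 2 ^ (t + fact j) \<le> 1 / 2 ^ d"
      by (intro divide_left_mono power_increasing) auto
    then show ?thesis
      unfolding teeth_def by (intro le_supI1 image_mono Sigma_mono) auto
  next
    case False
    then have "t < d" "fact j < d" by auto
    have "j \<le> i"
    proof (rule ccontr)
      assume "\<not> j \<le> i"
      then have "d \<le> fact j" unfolding d_def by (intro fact_mono) simp
      with \<open>fact j < d\<close> show False by simp
    qed
    then have "(16::nat) ^ fact j \<le> 16 ^ fact i"
      by (intro power_increasing fact_mono) auto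
    then have "(\<lambda>p. real p / 4 ^ t) ` {..<16 ^ fact j} \<subseteq> Y"
      using Y_I[OF \<open>t < d\<close>] by (meson image_subsetI lessThan_iff less_le_trans)
    then show ?thesis
      unfolding teeth_def by (intro le_supI2 image_mono Sigma_mono) auto
  qed
  have "comb \<subseteq> torus_proj ` ({0..1 / 2 ^ d} \<times> UNIV) \<union> torus_proj ` (UNIV \<times> Y)"
    unfolding comb_def using teeth \<open>0 \<in> Y\<close> by (intro Un_least UN_least) auto
  then have "covering_number (2 / 2 ^ d) comb \<le> enat (2 ^ d * (1 + card Y))"
    using covering_number_strip_and_circles_le[of "2 ^ d" Y comb] by (simp add: Y_def)
  also have "card Y \<le> d * 16 ^ fact i"
  proof -
    have "card Y \<le> card ({..<d} \<times> {..<16 ^ fact i :: nat})"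
      unfolding Y_def by (intro card_image_le) auto
    then show ?thesis by (simp add: card_cartesian_product)
  qed
  finally show ?thesis by simp
qed

text \<open>For \<open>t = 2 * g\<close> the heights are all the multiples of \<open>1 / 16 ^ g = 1 / 2 ^ (4 * g)\<close>, and
  the teeth, of length \<open>1 / 2 ^ (3 * g)\<close>, carry \<open>2 ^ g\<close> points with the same spacing. The scale is
  half of this spacing, to make the separation strict.\<close>

lemma covering_number_comb_ge:
  fixes j :: nat
  defines "g \<equiv> fact j"
  shows "enat (2 ^ (5 * g)) \<le> covering_number (1 / 2 ^ (4 * g + 1)) comb"
proof -
  have "enat (2 ^ g * 2 ^ (4 * g)) \<le> covering_number (1 / 2 ^ (4 * g + 1)) comb"
  proof (rule covering_number_grid_ge[where M = "2 ^ (4 * g)"])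
    show "(2::nat) ^ g \<le> 2 ^ (4 * g)"
      by (intro power_increasing) auto
    fix a b :: nat assume ab: "a < 2 ^ g" "b < 2 ^ (4 * g)"
    have "real a \<le> 2 ^ g"
      using ab(1) by (metis less_imp_le of_nat_le_iff of_nat_numeral of_nat_power)
    then have "real a / 2 ^ (4 * g) \<le> 2 ^ g / 2 ^ (4 * g)"
      by (intro divide_right_mono) auto
    also have "\<dots> = 1 / 2 ^ (2 * g + g)"
      by (simp add: field_simps flip: power_add)
    finally have x: "real a / 2 ^ (4 * g) \<in> {0..1 / 2 ^ (2 * g + g)}" by simp
    have "(2::real) ^ (4 * g) = 4 ^ (2 * g)" "(2::nat) ^ (4 * g) = 16 ^ g"
      by (simp_all add: power_mult)
    then have y: "real b / 2 ^ (4 * g) \<in> (\<lambda>p. real p / 4 ^ (2 * g)) ` {..<16 ^ g}"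
      using ab(2) by auto
    have "torus_proj (real a / 2 ^ (4 * g), real b / 2 ^ (4 * g)) \<in> teeth g (2 * g)"
      unfolding teeth_def using x y by blast
    then show "torus_proj (real a / real (2 ^ (4 * g)), real b / real (2 ^ (4 * g))) \<in> comb"
      unfolding comb_def g_def by auto
  qed (auto simp: field_simps)
  then show ?thesis by (simp flip: power_add)
qed

lemma filterlim_fact_at_top: "filterlim (fact :: nat \<Rightarrow> nat) at_top sequentially"
  by (rule filterlim_at_top_mono[OF filterlim_ident]) (simp add: fact_ge_self)

lemma lower_box_dim_comb_le: "lower_box_dim comb \<le> ereal (9 / 8)"
proof (rule lower_box_dim_le)
  let ?d = "\<lambda>i. fact (Suc i) :: nat"
  have d_lim: "filterlim ?d at_top sequentially"
    using filterlim_fact_at_top filterlim_Suc by (rule filterlim_compose)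
  have "filterlim (\<lambda>d::nat. 2 / 2 ^ d :: real) (at_right 0) sequentially"
    by real_asymp
  then show "filterlim (\<lambda>i. 2 / 2 ^ ?d i) (at_right (0::real)) sequentially"
    using d_lim by (rule filterlim_compose)
  have "\<forall>\<^sub>F d::nat in sequentially. ln (2 * real d) + 9 / 8 * ln 2 \<le> real d / 16 * ln 2"
    by real_asymp
  then have "\<forall>\<^sub>F i in sequentially. ln (2 * real (?d i)) + 9 / 8 * ln 2 \<le> real (?d i) / 16 * ln 2"
    using d_lim by (rule eventually_compose_filterlim)
  then show "\<forall>\<^sub>F i in sequentially. 0 < 2 ^ ?d i * (1 + ?d i * 16 ^ fact i)
      \<and> covering_number (2 / 2 ^ ?d i) comb \<le> enat (2 ^ ?d i * (1 + ?d i * 16 ^ fact i))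
      \<and> ln (real (2 ^ ?d i * (1 + ?d i * 16 ^ fact i))) \<le> 9 / 8 * (- ln (2 / 2 ^ ?d i))"
    \<comment> \<open>From \<open>i = 63\<close> on, \<open>fact (Suc i) \<ge> 64 * fact i\<close>, so that the factor \<open>16 ^ fact i\<close>
      contributes at most \<open>d / 16\<close> to the exponent. The factor \<open>2 * d\<close> and the difference
      between the scales \<open>2 / 2 ^ d\<close> and \<open>1 / 2 ^ d\<close> account for another \<open>d / 16\<close>.\<close>
    using eventually_ge_at_top[of 63]
  proof eventually_elim
    case (elim i)
    define d g where "d = ?d i" and "g = (fact i :: nat)"
    have dg: "64 * g \<le> d"
      using elim(2) by (simp add: d_def g_def)
    have pos: "1 \<le> d" "1 \<le> g" by (simp_all add: d_def g_def del: fact_Suc)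
    have "real (1 + d * 16 ^ g) \<le> 2 * real d * 16 ^ g"
    proof -
      have "1 \<le> d * 16 ^ g" using pos by simp
      then have "1 + d * 16 ^ g \<le> 2 * d * 16 ^ g" by linarith
      then have "real (1 + d * 16 ^ g) \<le> real (2 * d * 16 ^ g)"
        by (simp only: of_nat_le_iff)
      then show ?thesis by simp
    qed
    then have "ln (real (1 + d * 16 ^ g)) \<le> ln (2 * real d * 16 ^ g)"
      using pos by (subst ln_le_cancel_iff) (auto intro: add_pos_nonneg)
    also have "\<dots> = ln (2 * real d) + real (4 * g) * ln 2"
    proof -
      have "(16::real) ^ g = 2 ^ (4 * g)" by (simp add: power_mult)
      then show ?thesis using pos by (simp add: ln_mult ln_realpow)
    qed
    also have "\<dots> \<le> ln (2 * real d) + real d / 16 * ln 2"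
      using dg by (intro add_left_mono mult_right_mono) auto
    finally have tail: "ln (real (1 + d * 16 ^ g)) \<le> ln (2 * real d) + real d / 16 * ln 2" .
    have ln_split: "ln (2 ^ d * a) = real d * ln 2 + ln a" if "0 < a" for a :: real
      using that by (simp add: ln_mult ln_realpow)
    have "ln (real (2 ^ d * (1 + d * 16 ^ g))) = ln (2 ^ d * real (1 + d * 16 ^ g))"
      by (simp only: of_nat_mult of_nat_power of_nat_numeral)
    also have "\<dots> = real d * ln 2 + ln (real (1 + d * 16 ^ g))"
      by (rule ln_split) (subst of_nat_0_less_iff, simp)
    also have "\<dots> \<le> real d * ln 2 + ln (2 * real d) + real d / 16 * ln 2"
      using tail by linarith
    also have "\<dots> \<le> 9 / 8 * (real d * ln 2 - ln 2)"
      using elim(1) unfolding d_def[symmetric] by (simp add: algebra_simps)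
    also have "real d * ln 2 - ln 2 = - ln (2 / 2 ^ d :: real)"
      by (simp add: ln_div ln_realpow)
    finally show ?case
      using covering_number_comb_le[of i] by (simp add: d_def g_def del: fact_Suc)
  qed
qed

lemma upper_box_dim_comb_ge: "ereal (6 / 5) \<le> upper_box_dim comb"
proof (rule upper_box_dim_ge)
  have "filterlim (\<lambda>g::nat. 1 / 2 ^ (4 * g + 1) :: real) (at_right 0) sequentially"
    by real_asymp
  then show "filterlim (\<lambda>j. 1 / 2 ^ (4 * fact j + 1)) (at_right (0::real)) sequentially"
    using filterlim_fact_at_top by (rule filterlim_compose)
  show "\<forall>\<^sub>F j in sequentially. 0 < (2::nat) ^ (5 * fact j)
      \<and> enat (2 ^ (5 * fact j)) \<le> covering_number (1 / 2 ^ (4 * fact j + 1)) comb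
      \<and> 6 / 5 * (- ln (1 / 2 ^ (4 * fact j + 1))) \<le> ln (real (2 ^ (5 * fact j)))"
    \<comment> \<open>The inequality \<open>6 / 5 * (4 * g + 1) \<le> 5 * g\<close> holds from \<open>g = 6\<close> on.\<close>
    using eventually_ge_at_top[of 6]
  proof eventually_elim
    case (elim j)
    define g where "g = (fact j :: nat)"
    have "6 \<le> g" using elim fact_ge_self[of j] by (simp add: g_def)
    then have "6 / 5 * real (4 * g + 1) * ln 2 \<le> real (5 * g) * ln 2"
      by (intro mult_right_mono) auto
    moreover have "- ln (1 / 2 ^ (4 * g + 1)) = real (4 * g + 1) * ln 2"
      by (simp only: ln_div ln_realpow ln_one) simp
    ultimately have "6 / 5 * (- ln (1 / 2 ^ (4 * g + 1))) \<le> ln (real (2 ^ (5 * g)))"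
      by (simp add: ln_realpow)
    then show ?case
      using covering_number_comb_ge[of j] by (simp add: g_def)
  qed
qed

theorem theorem1p2:
  shows "\<exists>(m::int) (n::int) (F :: torus set).
           2 \<le> m \<and> m < n \<and> compact F \<and> F = toral_endo m n ` F \<and>
           lower_box_dim F < upper_box_dim F \<and>
           (\<nexists>d. has_box_dim F d)"
proof (intro exI conjI)
  have "lower_box_dim comb \<le> ereal (9 / 8)"
    by (rule lower_box_dim_comb_le)
  also have "\<dots> < ereal (6 / 5)" by simp
  also have "\<dots> \<le> upper_box_dim comb"
    by (rule upper_box_dim_comb_ge)
  finally show lt: "lower_box_dim comb < upper_box_dim comb" .
  then show "\<nexists>d. has_box_dim comb d"
    by (auto simp: has_box_dim_def)
  show "compact comb" by (rule compact_comb)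
  show "comb = toral_endo 2 4 ` comb" by (rule toral_endo_comb[symmetric])
qed auto

end
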